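(* Let $\mathcal{G}(A)$ be a complex-weighted graph on $n$ nodes that is either an undirected graph or a weight-balanced digraph, with Laplacian matrix $L\in\mathbb{C}^{n\times n}$, and assume that $L$ has $0$ as a simple eigenvalue. Let $L^{\dagger}$ be the Moore-Penrose pseudoinverse of $L$. Then the Laplacian flow $\dot{x}(t)=-Lx(t)$ achieves consensus if and only if the pseudoinverse Laplacian flow $\dot{x}(t)=-L^{\dagger}x(t)$ achieves consensus.
   Context: A complex-weighted graph $\mathcal{G}(A)=(\mathcal{V},\mathcal{E},A)$ on $n$ nodes has adjacency matrix $A=[a_{ij}]\in\mathbb{C}^{n\times n}$, with an edge between/from $i$ and/to $j$ exactly when $a_{ij}\neq 0$. It is undirected if $A=A^{T}$ (complex symmetric), and a digraph is weight-balanced if each node's in-degree equals its out-degree, i.e. $A\mathbb{1}_n=A^{T}\mathbb{1}_n$, where $\mathbb{1}_n$ is the all-ones vector. The Laplacian is $L=\operatorname{diag}(A\mathbb{1}_n)-A$; in both cases $L\mathbb{1}_n=0$ and $\mathbb{1}_n^{T}L=0$. An eigenvalue is simple if it has algebraic multiplicity one. A flow $\dot{x}=-Mx$, $M\in\mathbb{C}^{n\times n}$, achieves consensus if for every initial condition $x_0\in\mathbb{C}^n$ the solution $x(t)=e^{-Mt}x_0$ converges as $t\to\infty$ to a vector in $\operatorname{span}\{\mathbb{1}_n\}$. *)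

theory Defs
  imports "HOL-Analysis.Analysis" "HOL-Computational_Algebra.Polynomial"
begin

definition ones :: "complex^'n" where
  "ones = (\<chi> i. 1)"

definition diag_mat :: "complex^'n \<Rightarrow> complex^'n^'n" where
  "diag_mat v = (\<chi> i j. if i = j then v $ i else 0)"

(* A complex-weighted graph on the node set 'n is given by its adjacency matrix A;
   i and j are joined by an edge iff A $ i $ j \<noteq> 0. *)

definition undirected :: "complex^'n^'n \<Rightarrow> bool" where
  "undirected A \<longleftrightarrow> transpose A = A"

definition weight_balanced :: "complex^'n^'n \<Rightarrow> bool" where
  "weight_balanced A \<longleftrightarrow> A *v ones = transpose A *v ones"

definition laplacian :: "complex^'n^'n \<Rightarrow> complex^'n^'n" where
  "laplacian A = diag_mat (A *v ones) - A"

definition charpoly :: "complex^'n^'n \<Rightarrow> complex poly" where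
  "charpoly M = det (mat [:0, 1:] - (\<chi> i j. [:M $ i $ j:]))"

definition alg_multiplicity :: "complex^'n^'n \<Rightarrow> complex \<Rightarrow> nat" where
  "alg_multiplicity M z = order z (charpoly M)"

definition simple_eigenvalue :: "complex^'n^'n \<Rightarrow> complex \<Rightarrow> bool" where
  "simple_eigenvalue M z \<longleftrightarrow> alg_multiplicity M z = 1"

definition conj_transpose :: "complex^'n^'m \<Rightarrow> complex^'m^'n" where
  "conj_transpose M = (\<chi> i j. cnj (M $ j $ i))"

definition is_pinv :: "complex^'n^'n \<Rightarrow> complex^'n^'n \<Rightarrow> bool" where
  "is_pinv M X \<longleftrightarrow>
     M ** X ** M = M \<and> X ** M ** X = X \<and>
     conj_transpose (M ** X) = M ** X \<and> conj_transpose (X ** M) = X ** M"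

(* The description is proper: see ex1_pinv below. *)
definition pinv :: "complex^'n^'n \<Rightarrow> complex^'n^'n" where
  "pinv M = (THE X. is_pinv M X)"

(* Multiplication and exp from the type classes are not usable here: on vec, times is
   componentwise and no Banach algebra instance for matrices exists.
   Convergence of the series is summable_mat_exp below. *)
definition mat_exp :: "complex^'n^'n \<Rightarrow> complex^'n^'n" where
  "mat_exp M = (\<Sum>k. (((**) M) ^^ k) (mat 1) /\<^sub>R fact k)"

definition achieves_consensus :: "complex^'n^'n \<Rightarrow> bool" where
  "achieves_consensus M \<longleftrightarrow>
     (\<forall>x0. \<exists>v \<in> vec.span {ones}.
        ((\<lambda>t::real. mat_exp ((- t) *\<^sub>R M) *v x0) \<longlongrightarrow> v) at_top)"


lemma poly_det: "poly (det P) z = det (\<chi> i j. poly (P $ i $ j) z)"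
  by (simp add: det_def poly_sum poly_prod)

lemma poly_charpoly: "poly (charpoly M) z = det (mat z - M)"
proof -
  have "(\<chi> i j. poly ((mat [:0, 1:] - (\<chi> i j. [:M $ i $ j:])) $ i $ j) z) = mat z - M"
    by (simp add: vec_eq_iff mat_def)
  then show ?thesis
    by (simp add: charpoly_def poly_det)
qed

lemma poly_charpoly_eq_0_iff:
  "poly (charpoly M) z = 0 \<longleftrightarrow> (\<exists>v. v \<noteq> 0 \<and> M *v v = z *s v)"
proof -
  have z: "mat z *v v = z *s v" for v :: "complex^'n"
  proof -
    have "(if i = j then z else 0) * v $ j = (if i = j then z * v $ j else 0)" for i j by simp
    then show ?thesis
      by (simp add: vec_eq_iff matrix_vector_mult_def mat_def)
  qed
  have "det (mat z - M) \<noteq> 0 \<longleftrightarrow> (\<exists>B. B ** (mat z - M) = mat 1)"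
    using invertible_det_nz invertible_left_inverse by blast
  also have "\<dots> \<longleftrightarrow> (\<forall>v. (mat z - M) *v v = 0 \<longrightarrow> v = 0)"
    by (rule matrix_left_invertible_ker)
  finally show ?thesis
    by (auto simp: poly_charpoly matrix_vector_mult_diff_rdistrib z)
qed

lemma conj_transpose_mult: "conj_transpose (A ** B) = conj_transpose B ** conj_transpose A"
  by (simp add: conj_transpose_def matrix_matrix_mult_def vec_eq_iff mult.commute)

lemma conj_transpose_conj_transpose [simp]: "conj_transpose (conj_transpose A) = A"
  by (simp add: conj_transpose_def vec_eq_iff)

lemma conj_transpose_diff: "conj_transpose (A - B) = conj_transpose A - conj_transpose B"
  by (simp add: conj_transpose_def vec_eq_iff)

lemma matrix_mult_diff_left: "(A - B) ** C = A ** C - B ** (C :: complex^'n^'n)"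
  by (simp add: matrix_matrix_mult_def vec_eq_iff left_diff_distrib sum_subtractf)

lemma matrix_mult_diff_right: "A ** (B - C) = A ** B - A ** (C :: complex^'n^'n)"
  by (simp add: matrix_matrix_mult_def vec_eq_iff right_diff_distrib sum_subtractf)

lemma conj_transpose_mult_eq_0:
  assumes "conj_transpose A ** A = 0" shows "A = 0"
proof -
  have "A $ k $ i = 0" for i k
  proof -
    have "(conj_transpose A ** A) $ i $ i = of_real (\<Sum>k\<in>UNIV. (cmod (A $ k $ i))\<^sup>2)"
      by (simp add: matrix_matrix_mult_def conj_transpose_def complex_norm_square mult.commute
            del: of_real_power)
    then have "complex_of_real (\<Sum>k\<in>UNIV. (cmod (A $ k $ i))\<^sup>2) = 0"
      using assms by simp
    then have "(\<Sum>k\<in>UNIV. (cmod (A $ k $ i))\<^sup>2) = 0"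
      by (simp only: of_real_eq_0_iff)
    then show ?thesis
      by (simp add: sum_nonneg_eq_0_iff)
  qed
  then show ?thesis by (simp add: vec_eq_iff)
qed

lemma cancel_left:
  fixes M P Q :: "complex^'n^'n"
  assumes "conj_transpose M ** M ** P = conj_transpose M ** M ** Q"
  shows "M ** P = M ** Q"
proof -
  have "conj_transpose (M ** (P - Q)) ** (M ** (P - Q))
      = conj_transpose (P - Q) ** (conj_transpose M ** M ** P - conj_transpose M ** M ** Q)"
    by (simp add: conj_transpose_mult matrix_mul_assoc matrix_mult_diff_right
        matrix_mult_diff_left conj_transpose_diff)
  also have "\<dots> = 0" using assms by simp
  finally have "M ** (P - Q) = 0" by (rule conj_transpose_mult_eq_0)
  then show ?thesis by (simp add: matrix_mult_diff_right)
qed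

lemma cancel_right:
  fixes M P Q :: "complex^'n^'n"
  assumes "P ** M ** conj_transpose M = Q ** M ** conj_transpose M"
  shows "P ** M = Q ** M"
proof -
  have "conj_transpose (P ** M ** conj_transpose M) = conj_transpose (Q ** M ** conj_transpose M)"
    using assms by simp
  then have "conj_transpose M ** conj_transpose P = conj_transpose M ** conj_transpose Q"
    using cancel_left[of "conj_transpose M" "conj_transpose P" "conj_transpose Q"]
    by (simp add: conj_transpose_mult matrix_mul_assoc)
  then have "conj_transpose (P ** M) = conj_transpose (Q ** M)"
    by (simp add: conj_transpose_mult)
  then show ?thesis by (metis conj_transpose_conj_transpose)
qed

lemma ex_generalized_inverse:
  fixes B :: "complex^'n^'n"
  shows "\<exists>Y. B ** Y ** B = B"
proof -
  obtain g where g: "Vector_Spaces.linear (*s) (*s) g" "\<forall>v\<in>range ((*v) B). B *v g v = v"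
    using vec.linear_exists_right_inverse_on[OF matrix_vector_mul_linear_gen vec.subspace_UNIV]
    by blast
  have "(B ** matrix g ** B) *v x = B *v x" for x
    using g by (simp add: matrix_vector_mul_assoc[symmetric] matrix_works)
  then have "B ** matrix g ** B = B"
    by (simp add: matrix_eq)
  then show ?thesis by blast
qed

lemma ex_pinv: "\<exists>X. is_pinv M X"
proof -
  let ?H = "conj_transpose M"
  obtain Y where Y: "(?H ** M ** ?H) ** Y ** (?H ** M ** ?H) = ?H ** M ** ?H"
    using ex_generalized_inverse by blast
  define X where "X = ?H ** Y ** ?H"
  have "(?H ** M ** ?H ** Y ** ?H) ** M ** ?H = ?H ** M ** ?H"
    using Y by (simp add: matrix_mul_assoc)
  then have "(?H ** M ** ?H ** Y ** ?H) ** M = ?H ** M"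
    using cancel_right by blast
  then have "(?H ** M ** ?H ** Y) ** ?H ** conj_transpose ?H = mat 1 ** ?H ** conj_transpose ?H"
    by simp
  from cancel_right[OF this] have HMX: "?H ** M ** X = ?H"
    by (simp add: X_def matrix_mul_assoc)
  have "conj_transpose ?H ** ?H ** (Y ** ?H ** M ** ?H) = conj_transpose ?H ** ?H ** mat 1"
  proof -
    have "?H ** M ** (?H ** Y ** ?H ** M ** ?H) = ?H ** M ** ?H"
      using Y by (simp add: matrix_mul_assoc)
    from cancel_left[OF this] show ?thesis
      by (simp add: matrix_mul_assoc)
  qed
  from cancel_left[OF this] have XMH: "X ** M ** ?H = ?H"
    by (simp add: X_def matrix_mul_assoc)
  have 1: "conj_transpose (M ** X) ** M = M"
    using arg_cong[OF HMX, of conj_transpose] by (simp add: conj_transpose_mult matrix_mul_assoc)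
  have 2: "M ** conj_transpose (X ** M) = M"
    using arg_cong[OF XMH, of conj_transpose] by (simp add: conj_transpose_mult matrix_mul_assoc)
  have "conj_transpose (M ** X) ** (M ** X) = M ** X"
    using 1 by (simp add: matrix_mul_assoc)
  then have h1: "conj_transpose (M ** X) = M ** X"
    by (metis conj_transpose_mult conj_transpose_conj_transpose)
  have "(X ** M) ** conj_transpose (X ** M) = X ** M"
    using 2 by (simp add: matrix_mul_assoc[symmetric])
  then have h2: "conj_transpose (X ** M) = X ** M"
    by (metis conj_transpose_mult conj_transpose_conj_transpose)
  have "X ** M ** X = ?H ** Y ** (?H ** M ** X)"
    by (subst X_def) (simp add: matrix_mul_assoc)
  also have "\<dots> = X"
    unfolding HMX by (simp add: X_def)
  finally have "X ** M ** X = X" .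
  with 1 h1 h2 have "is_pinv M X"
    by (simp add: is_pinv_def)
  then show ?thesis by blast
qed

lemma is_pinv_unique:
  assumes "is_pinv M X" "is_pinv M Y"
  shows "X = Y"
proof -
  have X: "M ** X ** M = M" "X ** M ** X = X" "conj_transpose (M ** X) = M ** X"
      "conj_transpose (X ** M) = X ** M"
    and Y: "M ** Y ** M = M" "Y ** M ** Y = Y" "conj_transpose (M ** Y) = M ** Y"
      "conj_transpose (Y ** M) = Y ** M"
    using assms by (auto simp: is_pinv_def)
  have "M ** X = (M ** Y) ** (M ** X)"
    using Y(1) by (simp add: matrix_mul_assoc)
  also have "\<dots> = conj_transpose ((M ** X) ** (M ** Y))"
    using X(3) Y(3) by (simp add: conj_transpose_mult[of "M ** X"])
  also have "\<dots> = M ** Y"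
    using X(1) Y(3) by (simp add: matrix_mul_assoc)
  finally have a: "M ** X = M ** Y" .
  have "X ** M = (X ** M) ** (Y ** M)"
    using Y(1) by (metis matrix_mul_assoc)
  also have "\<dots> = conj_transpose ((Y ** M) ** (X ** M))"
    using X(4) Y(4) by (simp add: conj_transpose_mult[of "Y ** M"])
  also have "\<dots> = Y ** M"
    using X(1) Y(4) by (metis matrix_mul_assoc)
  finally have b: "X ** M = Y ** M" .
  show ?thesis
    by (metis a b X(2) Y(2) matrix_mul_assoc)
qed

lemma ex1_pinv: "\<exists>!X. is_pinv M X"
  using ex_pinv is_pinv_unique by blast

lemma is_pinv_pinv: "is_pinv M (pinv M)"
  unfolding pinv_def by (rule theI'[OF ex1_pinv])

lemma summable_mat_exp:
  fixes M :: "complex^'n^'n"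
  shows "summable (\<lambda>k. (((**) M) ^^ k) (mat 1) /\<^sub>R fact k)"
proof -
  let ?N = "\<lambda>X :: complex^'n^'n. \<Sum>i\<in>UNIV. \<Sum>j\<in>UNIV. cmod (X $ i $ j)"
  have le: "norm X \<le> ?N X" for X :: "complex^'n^'n"
  proof -
    have "norm X \<le> (\<Sum>i\<in>UNIV. norm (X $ i))"
      unfolding norm_vec_def[of X] by (intro L2_set_le_sum) auto
    also have "\<dots> \<le> ?N X"
      unfolding norm_vec_def[of "X $ _"] by (intro sum_mono L2_set_le_sum) auto
    finally show ?thesis .
  qed
  have mult: "?N (A ** B) \<le> ?N A * ?N B" for A B :: "complex^'n^'n"
  proof -
    have "?N (A ** B) \<le> (\<Sum>i\<in>UNIV. \<Sum>j\<in>UNIV. \<Sum>k\<in>UNIV. cmod (A $ i $ k) * cmod (B $ k $ j))"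
      unfolding matrix_matrix_mult_def
      by (simp, intro sum_mono) (rule order_trans[OF norm_sum], simp add: norm_mult)
    also have "\<dots> = (\<Sum>i\<in>UNIV. \<Sum>k\<in>UNIV. cmod (A $ i $ k) * (\<Sum>j\<in>UNIV. cmod (B $ k $ j)))"
      by (subst sum.swap) (simp add: sum_distrib_left)
    also have "\<dots> \<le> (\<Sum>i\<in>UNIV. \<Sum>k\<in>UNIV. cmod (A $ i $ k) * ?N B)"
      by (intro sum_mono mult_left_mono member_le_sum) (auto intro: sum_nonneg)
    also have "\<dots> = ?N A * ?N B"
      by (simp add: sum_distrib_right)
    finally show ?thesis .
  qed
  have pow: "?N ((((**) M) ^^ k) (mat 1)) \<le> ?N M ^ k * ?N (mat 1)" for k
  proof (induction k)
    case (Suc k)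
    have "?N ((((**) M) ^^ Suc k) (mat 1)) \<le> ?N M * ?N ((((**) M) ^^ k) (mat 1))"
      using mult by simp
    also have "\<dots> \<le> ?N M * (?N M ^ k * ?N (mat 1))"
      by (intro mult_left_mono Suc sum_nonneg) auto
    finally show ?case by (simp add: mult.assoc)
  qed simp
  show ?thesis
  proof (rule summable_comparison_test')
    show "summable (\<lambda>k. (?N M ^ k /\<^sub>R fact k) * ?N (mat 1))"
      by (intro summable_mult2 summable_exp_generic)
    show "norm ((((**) M) ^^ k) (mat 1) /\<^sub>R fact k) \<le> (?N M ^ k /\<^sub>R fact k) * ?N (mat 1)"
      if "k \<ge> 0" for k
      using mult_left_mono[OF order_trans[OF le pow], of "inverse (fact k)" k]
      by (simp add: mult.assoc)
  qed
qed

end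

(* With J the averaging matrix, L L^+ = L^+ L = I - J, so on the complement of the constant vectors
   the pseudoinverse is the inverse of L and its nonzero eigenvalues are the reciprocals of those
   of L; the sign of the real part is preserved. Consensus is in turn equivalent to positive real
   parts of all nonzero eigenvalues: a vector of zero mean is annihilated by p(L) for a polynomial p of
   minimal degree, whose roots are all nonzero eigenvalues, and splitting off one linear factor at a
   time reduces the decay of its orbit to scalar equations u' = -mu u - f with decaying f. *)

theory Submission
  imports Defs "HOL-Computational_Algebra.Fundamental_Theorem_Algebra"
begin

section \<open>The flow of a matrix\<close>

definition flow :: "complex^'n^'n \<Rightarrow> real \<Rightarrow> complex^'n \<Rightarrow> complex^'n" where
  "flow M t x = mat_exp ((- t) *\<^sub>R M) *v x"

text \<open>Trades matrix powers for the orbit of \<open>x\<close> under \<open>M\<close>; the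
  arguments below work with iterated vectors.\<close>

lemma matrix_power_scaleR_mult_vec:
  fixes M :: "complex^'n^'n"
  shows "(((**) (c *\<^sub>R M)) ^^ k) (mat 1) *v x = c ^ k *\<^sub>R (((*v) M) ^^ k) x"
proof (induction k)
  case (Suc k)
  have "(((**) (c *\<^sub>R M)) ^^ Suc k) (mat 1) *v x = (c *\<^sub>R M) *v ((((**) (c *\<^sub>R M)) ^^ k) (mat 1) *v x)"
    by (simp add: matrix_vector_mul_assoc)
  also have "\<dots> = (c *\<^sub>R M) *v (c ^ k *\<^sub>R (((*v) M) ^^ k) x)"
    by (simp only: Suc)
  also have "\<dots> = c ^ Suc k *\<^sub>R (((*v) M) ^^ Suc k) x"
    by (simp add: vec_eq_iff matrix_vector_mult_def scaleR_sum_right mult.commute)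
  finally show ?case .
qed simp

lemma bounded_linear_matrix_vector_mult_left:
  "bounded_linear (\<lambda>B::complex^'n^'n. B *v x)"
proof -
  have "linear (\<lambda>B::complex^'n^'n. B *v x)"
    by (rule linearI)
      (simp_all add: vec_eq_iff matrix_vector_mult_def distrib_right sum.distrib scaleR_sum_right)
  then show ?thesis
    by (simp add: linear_conv_bounded_linear)
qed

lemma flow_sums:
  fixes M :: "complex^'n^'n"
  shows "(\<lambda>k. ((((*v) M) ^^ k) x $ i / fact k) * (of_real (- t)) ^ k) sums (flow M t x $ i)"
proof -
  have "(\<lambda>k. ((((**) ((- t) *\<^sub>R M)) ^^ k) (mat 1) /\<^sub>R fact k)) sums mat_exp ((- t) *\<^sub>R M)"
    unfolding mat_exp_def by (rule summable_sums[OF summable_mat_exp])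
  from bounded_linear.sums[OF bounded_linear_compose[OF bounded_linear_vec_nth[of i]
      bounded_linear_matrix_vector_mult_left[of x]] this]
  have "(\<lambda>k. ((((**) ((- t) *\<^sub>R M)) ^^ k) (mat 1) /\<^sub>R fact k *v x) $ i) sums (flow M t x $ i)"
    by (simp add: flow_def)
  moreover have "((((**) ((- t) *\<^sub>R M)) ^^ k) (mat 1) /\<^sub>R fact k *v x) $ i
      = ((((*v) M) ^^ k) x $ i / fact k) * (of_real (- t)) ^ k" for k
  proof -
    have "((((**) ((- t) *\<^sub>R M)) ^^ k) (mat 1) /\<^sub>R fact k *v x)
        = ((((**) ((- t) *\<^sub>R M)) ^^ k) (mat 1) *v x) /\<^sub>R fact k"
      by (rule linear_cmul[OF bounded_linear.linear[OF bounded_linear_matrix_vector_mult_left]])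
    then show ?thesis
      unfolding matrix_power_scaleR_mult_vec vector_scaleR_component
      by (simp add: scaleR_conv_of_real[where 'a = complex] divide_inverse mult_ac)
  qed
  ultimately show ?thesis by simp
qed

lemma flow_diff: "flow M t (x - y) = flow M t x - flow M t y"
  by (simp add: flow_def matrix_vector_mult_diff_distrib)

lemma flow_smult: "flow M t (c *s x) = c *s flow M t x"
  by (simp add: flow_def vector_scalar_commute)

lemma flow_eigenvector:
  assumes "M *v v = \<mu> *s v"
  shows "flow M t v = exp (- of_real t * \<mu>) *s v"
proof -
  have pow: "(((*v) M) ^^ k) v = \<mu> ^ k *s v" for k
    by (induction k) (simp_all add: vector_scalar_commute assms mult.commute)
  have "flow M t v $ i = exp (- of_real t * \<mu>) * v $ i" for i
  proof -
    have "(\<lambda>k. (- of_real t * \<mu>) ^ k /\<^sub>R fact k * v $ i) sums (exp (- of_real t * \<mu>) * v $ i)"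
      by (intro sums_mult2 exp_converges)
    moreover have "(- of_real t * \<mu>) ^ k /\<^sub>R fact k * v $ i
        = ((((*v) M) ^^ k) v $ i / fact k) * (of_real (- t)) ^ k" for k
      unfolding pow minus_mult_left[symmetric] minus_mult_right[of _ \<mu>] power_mult_distrib
      by (simp add: scaleR_conv_of_real power_minus[of "of_real t"] power_minus[of \<mu>] divide_inverse mult_ac)
    ultimately show ?thesis
      using flow_sums[of M v i t] by (metis (no_types, lifting) sums_cong sums_unique2)
  qed
  then show ?thesis by (simp add: vec_eq_iff)
qed

text \<open>Each coordinate is an entire power series evaluated at \<open>- t\<close>. Termwise
  differentiation turns the coefficients for \<open>x\<close> into those for \<open>M *v x\<close>,
  and the inner derivative gives the sign.\<close>

lemma has_vector_derivative_flow:
  "((\<lambda>t. flow M t x $ i) has_vector_derivative - (flow M t (M *v x) $ i)) (at t)"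
proof -
  define c where "c k = (((*v) M) ^^ k) x $ i / fact k" for k
  define F where "F z = (\<Sum>k. c k * z ^ k)" for z
  have real_sums: "(\<lambda>k. c k * (of_real (- s)) ^ k) sums (flow M s x $ i)" for s
    unfolding c_def by (rule flow_sums)
  \<comment> \<open>The flow gives convergence at real points only; \<open>norm z + 1\<close> is one
    of them and dominates \<open>z\<close>.\<close>
  have summ: "summable (\<lambda>k. c k * z ^ k)" for z
  proof (rule powser_inside)
    show "summable (\<lambda>k. c k * (of_real (- (- (norm z + 1)))) ^ k)"
      by (rule sums_summable[OF real_sums])
    show "norm z < norm (complex_of_real (- (- (norm z + 1))))"
      unfolding norm_of_real by simp
  qed
  have F: "F (of_real (- s)) = flow M s x $ i" for s
    unfolding F_def by (rule sums_unique[OF real_sums, symmetric])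
  have "diffs c k = (((*v) M) ^^ k) (M *v x) $ i / fact k" for k
    by (simp add: diffs_def c_def funpow_swap1 field_simps del: of_nat_Suc)
  then have "(\<Sum>k. diffs c k * (of_real (- t)) ^ k) = flow M t (M *v x) $ i"
    using sums_unique[OF flow_sums[of M "M *v x" i t]] by simp
  then have "(F has_field_derivative (flow M t (M *v x) $ i)) (at (of_real (- t)))"
    using termdiffs_strong_converges_everywhere[OF summ, of "of_real (- t)"]
    by (simp add: F_def[abs_def])
  moreover have "((\<lambda>s. complex_of_real (- s)) has_vector_derivative of_real (- 1)) (at t)"
    by (rule has_vector_derivative_of_real) (auto intro!: derivative_eq_intros)
  ultimately have "((F \<circ> (\<lambda>s. of_real (- s))) has_vector_derivative
      of_real (- 1) * (flow M t (M *v x) $ i)) (at t)"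
    by (rule field_vector_diff_chain_at[rotated])
  moreover have "F \<circ> (\<lambda>s. of_real (- s)) = (\<lambda>s. flow M s x $ i)"
    by (simp add: fun_eq_iff F del: of_real_minus)
  ultimately show ?thesis by simp
qed

section \<open>Exponential decay\<close>

text \<open>An explicit exponential rate, because such a bound can be integrated against the
  integrating factor below.\<close>

definition decays :: "(real \<Rightarrow> complex) \<Rightarrow> bool" where
  "decays u \<longleftrightarrow> (\<exists>a>0. \<exists>C. \<forall>t\<ge>0. norm (u t) \<le> C * exp (- a * t))"

lemma decays_tendsto_0:
  assumes "decays u" shows "(u \<longlongrightarrow> 0) at_top"
proof -
  obtain a C where a: "a > 0" "\<And>t. t \<ge> 0 \<Longrightarrow> norm (u t) \<le> C * exp (- a * t)"
    using assms by (auto simp: decays_def)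
  have "filterlim (\<lambda>t. - a * t) at_bot at_top"
    by (rule filterlim_tendsto_neg_mult_at_bot[OF tendsto_const _ filterlim_ident]) (use a in simp)
  from tendsto_mult_right_zero[OF filterlim_compose[OF exp_at_bot this]]
  have "((\<lambda>t. C * exp (- a * t)) \<longlongrightarrow> 0) at_top" .
  then show ?thesis
    by (rule Lim_null_comparison[rotated])
      (rule eventually_mono[OF eventually_ge_at_top[of 0]], rule a(2))
qed

text \<open>By the integrating factor \<open>exp (\<mu> t)\<close>; halving the rate avoids resonance between \<open>\<mu>\<close> and
  the forcing term.\<close>

lemma decays_linear_ode:
  fixes u f :: "real \<Rightarrow> complex"
  assumes u: "\<And>t. (u has_vector_derivative (- \<mu> * u t - f t)) (at t)"
    and "decays f" and "Re \<mu> > 0"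
  shows "decays u"
proof -
  obtain a C where a: "a > 0" and C: "\<And>t. t \<ge> 0 \<Longrightarrow> norm (f t) \<le> C * exp (- a * t)"
    using \<open>decays f\<close> by (auto simp: decays_def)
  have "C \<ge> 0" using order_trans[OF norm_ge_zero C[of 0]] by simp
  define b where "b = min a (Re \<mu>) / 2"
  have b: "b > 0" "b < a" "b < Re \<mu>"
    using a \<open>Re \<mu> > 0\<close> by (auto simp: b_def min_def)
  define g where "g t = exp (of_real t * \<mu>) * u t" for t
  \<comment> \<open>Chosen so that \<open>\<phi>\<close> below is an antiderivative of the bound on
    the derivative of \<open>g\<close>; the denominator is positive since
    \<open>b < Re \<mu>\<close>.\<close>
  define D where "D = C / (Re \<mu> - b)"
  have g': "(g has_vector_derivative - exp (of_real t * \<mu>) * f t) (at t)" for t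
  proof -
    have "((\<lambda>t. exp (of_real t * \<mu>)) has_vector_derivative (\<mu> * exp (of_real t * \<mu>))) (at t)"
      by (auto intro!: derivative_eq_intros has_vector_derivative_real_field)
    from has_vector_derivative_mult[OF this u] show ?thesis
      unfolding g_def[abs_def] by (rule has_vector_derivative_eq_rhs) (simp add: algebra_simps)
  qed
  define \<phi> where "\<phi> t = D * exp ((Re \<mu> - b) * t)" for t
  have \<phi>': "(\<phi> has_vector_derivative C * exp ((Re \<mu> - b) * t)) (at t)" for t
    unfolding has_real_derivative_iff_has_vector_derivative[symmetric] \<phi>_def[abs_def] D_def
    using b by (auto intro!: derivative_eq_intros)
  have le: "norm (- exp (of_real t * \<mu>) * f t) \<le> C * exp ((Re \<mu> - b) * t)" if "t \<ge> 0" for t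
  proof -
    have "norm (- exp (of_real t * \<mu>) * f t) \<le> exp (t * Re \<mu>) * (C * exp (- a * t))"
      using C[OF that] by (simp add: norm_mult)
    also have "\<dots> \<le> exp (t * Re \<mu>) * (C * exp (- b * t))"
      using b \<open>C \<ge> 0\<close> that by (intro mult_left_mono) (auto intro: mult_right_mono)
    also have "\<dots> = C * exp ((Re \<mu> - b) * t)"
      by (simp add: algebra_simps exp_diff exp_minus exp_add divide_inverse)
    finally show ?thesis .
  qed
  have bound: "norm (g t) \<le> norm (g 0) + \<phi> t" if "t \<ge> 0" for t
  proof (cases "t = 0")
    case False
    have "norm (g t - g 0) \<le> \<phi> t - \<phi> 0"
    proof (rule differentiable_bound_general[where f' = "\<lambda>t. - exp (of_real t * \<mu>) * f t"
          and \<phi>' = "\<lambda>t. C * exp ((Re \<mu> - b) * t)"])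
      show "0 < t" using that False by simp
      show "continuous_on {0..t} g" "continuous_on {0..t} \<phi>"
        using g' \<phi>' by (auto intro!: continuous_at_imp_continuous_on has_vector_derivative_continuous)
    qed (use g' \<phi>' le in auto)
    moreover have "\<phi> 0 \<ge> 0" using b \<open>C \<ge> 0\<close> by (simp add: \<phi>_def D_def)
    ultimately show ?thesis
      using norm_triangle_ineq2[of "g t" "g 0"] by linarith
  qed (use b \<open>C \<ge> 0\<close> in \<open>simp add: \<phi>_def D_def\<close>)
  \<comment> \<open>Undoing the integrating factor: the initial value decays at rate
    \<open>Re \<mu>\<close>, the \<open>\<phi>\<close> part at rate \<open>b\<close>, and the slower
    rate \<open>b\<close> covers both.\<close>
  have "norm (u t) \<le> (norm (g 0) + D) * exp (- b * t)" if "t \<ge> 0" for t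
  proof -
    have "u t = exp (- (of_real t * \<mu>)) * g t"
      by (simp add: g_def mult.assoc[symmetric] exp_add[symmetric])
    then have "norm (u t) = exp (- (t * Re \<mu>)) * norm (g t)"
      by (simp add: norm_mult)
    also have "\<dots> \<le> exp (- (t * Re \<mu>)) * (norm (g 0) + \<phi> t)"
      using bound[OF that] by simp
    also have "\<dots> = norm (g 0) * exp (- (t * Re \<mu>)) + D * exp (- b * t)"
      by (simp add: \<phi>_def algebra_simps exp_add[symmetric])
    also have "\<dots> \<le> norm (g 0) * exp (- b * t) + D * exp (- b * t)"
      using mult_right_mono[of b "Re \<mu>" t] b that
      by (auto intro!: mult_left_mono simp: mult.commute)
    finally show ?thesis by (simp add: algebra_simps)
  qed
  with b show ?thesis by (auto simp: decays_def)
qed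

section \<open>Polynomials acting on vectors\<close>

text \<open>The vector p(M) x.\<close>

definition poly_act :: "complex^'n^'n \<Rightarrow> complex poly \<Rightarrow> complex^'n \<Rightarrow> complex^'n" where
  "poly_act M p x = (\<Sum>k\<le>degree p. coeff p k *s (((*v) M) ^^ k) x)"

lemma poly_act_altdef:
  assumes "degree p \<le> N"
  shows "poly_act M p x = (\<Sum>k\<le>N. coeff p k *s (((*v) M) ^^ k) x)"
  unfolding poly_act_def
  by (rule sum.mono_neutral_left) (use assms in \<open>auto simp: coeff_eq_0\<close>)

lemma poly_act_0 [simp]: "poly_act M 0 x = 0"
  by (simp add: poly_act_def)

lemma poly_act_add: "poly_act M (p + q) x = poly_act M p x + poly_act M q x"
proof -
  define N where "N = max (degree p) (degree q)"
  have "degree p \<le> N" "degree q \<le> N" "degree (p + q) \<le> N"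
    by (auto simp: N_def degree_add_le_max)
  then show ?thesis
    by (simp add: poly_act_altdef sum.distrib)
qed

lemma poly_act_smult: "poly_act M (smult c p) x = c *s poly_act M p x"
  by (simp add: poly_act_altdef[OF degree_smult_le] poly_act_def vec.scale_sum_right)

lemma poly_act_pCons: "poly_act M (pCons a p) x = a *s x + M *v poly_act M p x"
proof -
  have "poly_act M (pCons a p) x
      = (\<Sum>k\<le>Suc (degree p). coeff (pCons a p) k *s (((*v) M) ^^ k) x)"
    by (rule poly_act_altdef) (rule degree_pCons_le)
  also have "\<dots> = a *s x + (\<Sum>k\<le>degree p. coeff p k *s (M *v (((*v) M) ^^ k) x))"
    by (subst sum.atMost_Suc_shift) simp
  also have "(\<Sum>k\<le>degree p. coeff p k *s (M *v (((*v) M) ^^ k) x)) = M *v poly_act M p x"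
    by (simp add: poly_act_def vector_scalar_commute
        linear_sum[OF matrix_vector_mul_linear])
  finally show ?thesis .
qed

text \<open>With the factor outermost, a root of an annihilating polynomial makes
  \<open>poly_act M q x\<close> satisfy the eigenvector equation.\<close>

lemma poly_act_linear_mult:
  "poly_act M ([:- \<mu>, 1:] * q) x = M *v poly_act M q x - \<mu> *s poly_act M q x"
proof -
  have "[:- \<mu>, 1:] * q = smult (- \<mu>) q + pCons 0 q" by simp
  then show ?thesis
    by (simp only: poly_act_add poly_act_smult poly_act_pCons) simp
qed

text \<open>\<open>M\<close> commutes with its polynomials, so the factor can also be moved onto the
  argument; the induction for the decay needs this form.\<close>

lemma poly_act_linear_mult_right:
  "poly_act M ([:- \<mu>, 1:] * q) x = poly_act M q (M *v x - \<mu> *s x)"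
proof -
  have "M *v poly_act M q x - \<mu> *s poly_act M q x = poly_act M q (M *v x - \<mu> *s x)"
  proof (induction q)
    case (pCons a q)
    show ?case
      by (simp add: poly_act_pCons pCons.IH[symmetric] matrix_vector_right_distrib
          matrix_vector_mult_diff_distrib vector_scalar_commute)
  qed simp
  then show ?thesis by (simp only: poly_act_linear_mult)
qed

text \<open>The orbit of \<open>x\<close> lies in a finite-dimensional space; the coefficients of a
  linear dependence within it form the polynomial.\<close>

lemma ex_annihilating_poly:
  fixes M :: "complex^'n^'n"
  shows "\<exists>p. p \<noteq> 0 \<and> poly_act M p x = 0"
proof -
  let ?f = "\<lambda>k. (((*v) M) ^^ k) x"
  have coeffs: "coeff (\<Sum>k\<in>T. monom (w k) k) j = (if j \<in> T then w j else 0)"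
    if "finite T" for T and w :: "nat \<Rightarrow> complex" and j
    using that by (simp add: coeff_sum)
  have witness: ?thesis
    if T: "finite T" "j \<in> T" "w j \<noteq> 0" "(\<Sum>k\<in>T. w k *s ?f k) = 0" for T w j
  proof -
    define p where "p = (\<Sum>k\<in>T. monom (w k) k)"
    define N where "N = max (degree p) (Max T)"
    have "p \<noteq> 0"
      using T coeffs[of T w j] by (auto simp: p_def)
    moreover have "poly_act M p x = (\<Sum>k\<le>N. coeff p k *s ?f k)"
      by (rule poly_act_altdef) (simp add: N_def)
    moreover have "\<dots> = (\<Sum>k\<in>T. w k *s ?f k)"
    proof (rule sum.mono_neutral_cong_right)
      show "T \<subseteq> {..N}" using T(1) by (auto simp: N_def max.coboundedI2)
    qed (use coeffs[OF T(1)] in \<open>auto simp: p_def\<close>)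
    ultimately show ?thesis using T by auto
  qed
  show ?thesis
  \<comment> \<open>Dependence speaks of sets of vectors, so a repetition in the orbit is treated
    apart: it yields the polynomial X^i - X^j.\<close>
  proof (cases "inj_on ?f UNIV")
    case False
    then obtain i j where "i \<noteq> j" "?f i = ?f j" by (auto simp: inj_on_def)
    then show ?thesis
      by (intro witness[of "{i, j}" i "\<lambda>k. if k = i then 1 else - 1"])
        (auto simp: vec_eq_iff)
  next
    case True
    then have "infinite (range ?f)"
      by (simp add: finite_image_iff)
    then have "vec.dependent (range ?f)"
      using vec.independent_bound_general by blast
    then obtain S w where S: "finite S" "S \<subseteq> range ?f" "(\<Sum>v\<in>S. w v *s v) = 0" "\<exists>v\<in>S. w v \<noteq> 0"
      unfolding vec.dependent_explicit by blast
    define T where "T = ?f -` S"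
    have T: "?f ` T = S"
      unfolding T_def by (simp only: image_vimage_eq Int_absorb2[OF S(2)])
    have inj: "inj_on ?f T" using True by (rule inj_on_subset) simp
    obtain j where "j \<in> T" "w (?f j) \<noteq> 0" using S(4) T by blast
    moreover have "finite T" using S(1) finite_image_iff[OF inj] T by simp
    moreover have "(\<Sum>k\<in>T. w (?f k) *s ?f k) = 0"
      using S(3) sum.reindex[OF inj, of "\<lambda>v. w v *s v"] by (simp only: T o_def)
    ultimately show ?thesis using witness[of T j "\<lambda>k. w (?f k)"] by satx
  qed
qed

text \<open>Induction on the degree: for a root \<open>\<mu>\<close>, the vector
  \<open>y = M *v x - \<mu> *s x\<close> is annihilated by the cofactor \<open>q\<close>, so its
  orbit decays, and it is the forcing term in the equation for the orbit of
  \<open>x\<close>.\<close>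

lemma decays_flow_of_annihilating_poly:
  fixes M :: "complex^'n^'n"
  assumes "p \<noteq> 0" "poly_act M p x = 0" "\<And>z. poly p z = 0 \<Longrightarrow> Re z > 0"
  shows "decays (\<lambda>t. flow M t x $ i)"
  using assms
proof (induction "degree p" arbitrary: p x)
  case 0
  then obtain c where "p = [:c:]" by (metis degree_eq_zeroE)
  then have "x = 0" using 0 by (simp add: poly_act_pCons)
  then have "flow M t x = 0" for t by (simp add: flow_def)
  then show ?case
    unfolding decays_def by (intro exI[of _ "1::real"] conjI) simp_all
next
  case (Suc n)
  have "\<not> constant (poly p)"
    using Suc.hyps(2) by (simp add: constant_degree)
  then obtain \<mu> where "poly p \<mu> = 0"
    using fundamental_theorem_of_algebra by blast
  then obtain q where q: "p = [:- \<mu>, 1:] * q"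
    unfolding poly_eq_0_iff_dvd by (rule dvdE)
  define y where "y = M *v x - \<mu> *s x"
  have "q \<noteq> 0" using q Suc.prems by auto
  have "decays (\<lambda>t. flow M t y $ i)"
  proof (rule Suc.hyps(1))
    show "n = degree q"
      using Suc.hyps(2) \<open>q \<noteq> 0\<close> unfolding q by (subst (asm) degree_mult_eq) auto
    show "poly_act M q y = 0"
      using Suc.prems(2) unfolding q y_def poly_act_linear_mult_right .
    show "Re z > 0" if "poly q z = 0" for z
      using Suc.prems(3)[of z] that by (simp add: q)
  qed (rule \<open>q \<noteq> 0\<close>)
  moreover have "Re \<mu> > 0" using Suc.prems(3) \<open>poly p \<mu> = 0\<close> .
  moreover have "((\<lambda>t. flow M t x $ i) has_vector_derivative
      (- \<mu> * flow M t x $ i - flow M t y $ i)) (at t)" for t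
    using has_vector_derivative_flow[of M x i t] by (simp add: y_def flow_diff flow_smult)
  ultimately show ?case
    by (rule decays_linear_ode[where \<mu> = \<mu> and f = "\<lambda>t. flow M t y $ i"
          and u = "\<lambda>t. flow M t x $ i", rotated])
qed

section \<open>Consensus and the spectrum\<close>

text \<open>The orthogonal projection onto the span of \<open>ones\<close>.\<close>

definition avg_mat :: "complex^'n^'n" where
  "avg_mat = (\<chi> i j. 1 / of_nat CARD('n))"

lemma avg_mat_mult_vec: "avg_mat *v x = ((\<Sum>j\<in>UNIV. x $ j) / of_nat CARD('n)) *s (ones :: complex^'n)"
  by (simp add: vec_eq_iff avg_mat_def matrix_vector_mult_def ones_def sum_divide_distrib)

lemma avg_mat_ones [simp]: "avg_mat *v ones = (ones :: complex^'n)"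
  by (simp add: avg_mat_mult_vec) (simp add: ones_def)

lemma avg_mat_idem [simp]: "avg_mat ** avg_mat = (avg_mat :: complex^'n^'n)"
  by (simp add: vec_eq_iff avg_mat_def matrix_matrix_mult_def)

lemma conj_transpose_avg_mat [simp]: "conj_transpose avg_mat = avg_mat"
  by (simp add: vec_eq_iff avg_mat_def conj_transpose_def)

lemma eigenvector_avg_eq_0:
  assumes "avg_mat ** M = 0" "M *v v = \<mu> *s v" "\<mu> \<noteq> 0"
  shows "avg_mat *v v = 0"
proof -
  have "\<mu> *s (avg_mat *v v) = (avg_mat ** M) *v v"
    by (simp add: matrix_vector_mul_assoc[symmetric] assms(2) vector_scalar_commute)
  with assms show ?thesis by simp
qed

lemma eigenvalue_of_achieves_consensus:
  fixes M :: "complex^'n^'n"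
  assumes "achieves_consensus M" "avg_mat ** M = 0"
    and v: "M *v v = \<mu> *s v" "v \<noteq> 0" "\<mu> \<noteq> 0"
  shows "Re \<mu> > 0"
proof -
  have Jv: "avg_mat *v v = 0" using eigenvector_avg_eq_0 assms by blast
  obtain w where "w \<in> vec.span {ones}" and lim: "((\<lambda>t. flow M t v) \<longlongrightarrow> w) at_top"
    using assms(1) unfolding achieves_consensus_def flow_def by blast
  then obtain c where w: "w = c *s ones" by (auto simp: vec.span_singleton)
  \<comment> \<open>The orbit of \<open>v\<close> has zero mean at all times while averaging fixes
    multiples of \<open>ones\<close>; hence the limit \<open>w\<close> is zero.\<close>
  have "((\<lambda>t. avg_mat *v flow M t v) \<longlongrightarrow> avg_mat *v w) at_top"
    by (intro bounded_linear.tendsto[OF matrix_vector_mul_bounded_linear] lim)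
  then have "avg_mat *v w = 0"
    using Jv by (simp add: flow_eigenvector[OF v(1)] vector_scalar_commute tendsto_const_iff)
  then have "w = 0" by (simp add: w vector_scalar_commute)
  obtain i where i: "v $ i \<noteq> 0" using v(2) by (auto simp: vec_eq_iff)
  have "((\<lambda>t. norm (flow M t v $ i)) \<longlongrightarrow> 0) at_top"
    using tendsto_norm_zero[OF tendsto_vec_nth[OF lim, of i, unfolded \<open>w = 0\<close> zero_index]] .
  then have "((\<lambda>t. exp (- (t * Re \<mu>)) * norm (v $ i)) \<longlongrightarrow> 0) at_top"
    by (simp add: flow_eigenvector[OF v(1)] norm_mult)
  from tendsto_mult_left_zero[OF this, of "inverse (norm (v $ i))"]
  have "((\<lambda>t. exp (- (t * Re \<mu>))) \<longlongrightarrow> 0) at_top"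
    using i by (simp add: mult.assoc)
  \<comment> \<open>A single positive time at which the exponential is below 1 settles the sign of
    \<open>Re \<mu>\<close>.\<close>
  then have "\<forall>\<^sub>F t in at_top. exp (- (t * Re \<mu>)) < 1"
    by (rule order_tendstoD) simp
  then have "\<forall>\<^sub>F t in at_top. exp (- (t * Re \<mu>)) < 1 \<and> t > 0"
    by (intro eventually_conj eventually_gt_at_top)
  then obtain t where t: "exp (- (t * Re \<mu>)) < 1" "t > 0"
    using eventually_happens' trivial_limit_at_top_linorder by blast
  then have "0 < t * Re \<mu>" by simp
  then show ?thesis using t(2) by (rule zero_less_mult_pos)
qed

text \<open>The mean of the initial state is stationary and the zero-mean remainder decays, so the
  consensus value is the mean. \<open>X\<close> serves to exclude nonzero kernel vectors of zero
  mean.\<close>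

lemma achieves_consensus_of_eigenvalues:
  fixes M X :: "complex^'n^'n"
  assumes "M ** avg_mat = 0" "avg_mat ** M = 0" and XM: "X ** M = mat 1 - avg_mat"
    and ev: "\<And>\<mu> v. M *v v = \<mu> *s v \<Longrightarrow> v \<noteq> 0 \<Longrightarrow> \<mu> \<noteq> 0 \<Longrightarrow> Re \<mu> > 0"
  shows "achieves_consensus M"
proof -
  have decay: "decays (\<lambda>t. flow M t x $ i)" if Jx: "avg_mat *v x = 0" for x i
  proof -
    define ann where "ann p \<longleftrightarrow> p \<noteq> 0 \<and> poly_act M p x = 0" for p
    obtain p\<^sub>0 where "ann p\<^sub>0" using ex_annihilating_poly[of M x] unfolding ann_def by blast
    then obtain p where "ann p" and "\<And>q. ann q \<Longrightarrow> degree p \<le> degree q"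
      using ex_has_least_nat[of ann p\<^sub>0 degree] by blast
    then have p: "p \<noteq> 0" "poly_act M p x = 0"
      and min: "\<And>q. q \<noteq> 0 \<Longrightarrow> poly_act M q x = 0 \<Longrightarrow> degree p \<le> degree q"
      by (simp_all add: ann_def)
    have Jq: "avg_mat *v poly_act M q x = 0" for q
      by (induction q)
        (simp_all add: poly_act_pCons matrix_vector_right_distrib vector_scalar_commute Jx
          matrix_vector_mul_assoc assms)
    have "Re \<mu> > 0" if "poly p \<mu> = 0" for \<mu>
    proof -
      obtain q where q: "p = [:- \<mu>, 1:] * q" using \<open>poly p \<mu> = 0\<close> unfolding poly_eq_0_iff_dvd by (rule dvdE)
      then have "q \<noteq> 0" using p by auto
      then have "degree p = Suc (degree q)" unfolding q by (subst degree_mult_eq) auto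
      \<comment> \<open>By minimality the cofactor \<open>q\<close> does not annihilate
        \<open>x\<close>, so \<open>poly_act M q x\<close> is a genuine eigenvector for
        \<open>\<mu>\<close>.\<close>
      then have nz: "poly_act M q x \<noteq> 0" using min[OF \<open>q \<noteq> 0\<close>] by auto
      have e: "M *v poly_act M q x = \<mu> *s poly_act M q x"
        using p(2) unfolding q poly_act_linear_mult by simp
      have "\<mu> \<noteq> 0"
      proof
        assume "\<mu> = 0"
        \<comment> \<open>On zero-mean vectors \<open>X ** M\<close> is the identity, so this vector
          would vanish.\<close>
        then have "(X ** M) *v poly_act M q x = 0"
          using e by (simp add: matrix_vector_mul_assoc[symmetric])
        then show False
          using nz Jq[of q] by (simp add: XM matrix_vector_mult_diff_rdistrib)
      qed
      then show ?thesis using ev e nz by blast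
    qed
    then show ?thesis using decays_flow_of_annihilating_poly p by blast
  qed
  show ?thesis
    unfolding achieves_consensus_def flow_def[symmetric]
  proof (intro allI bexI)
    fix x :: "complex^'n"
    let ?J = "avg_mat *v x"
    show "?J \<in> vec.span {ones}"
      by (auto simp: avg_mat_mult_vec vec.span_singleton)
    have "M *v ?J = 0 *s ?J"
      by (simp add: matrix_vector_mul_assoc assms)
    from flow_eigenvector[OF this] have "flow M t ?J = ?J" for t by simp
    then have eq: "flow M t x = ?J + flow M t (x - ?J)" for t
      by (simp add: flow_diff)
    have "avg_mat *v (x - ?J) = 0"
      by (simp add: matrix_vector_mult_diff_distrib matrix_vector_mul_assoc)
    then have "((\<lambda>t. flow M t (x - ?J)) \<longlongrightarrow> 0) at_top"
      using decays_tendsto_0[OF decay] by (intro vec_tendstoI) simp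
    from tendsto_add[OF tendsto_const[of ?J] this]
    show "((\<lambda>t. flow M t x) \<longlongrightarrow> ?J) at_top" by (simp add: eq)
  qed
qed

text \<open>An eigenvector of \<open>X\<close> for \<open>\<mu> \<noteq> 0\<close> has zero mean,
  hence is one of \<open>M\<close> for \<open>inverse \<mu>\<close>. The hypotheses are symmetric in
  \<open>M\<close> and \<open>X\<close>, so both directions of the equivalence are
  instances.\<close>

lemma achieves_consensus_transfer:
  fixes M X :: "complex^'n^'n"
  assumes "M ** avg_mat = 0" "avg_mat ** M = 0" "X ** avg_mat = 0" "avg_mat ** X = 0"
    and MX: "M ** X = mat 1 - avg_mat" "X ** M = mat 1 - avg_mat"
    and "achieves_consensus M"
  shows "achieves_consensus X"
proof (rule achieves_consensus_of_eigenvalues[where X = M])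
  fix \<mu> v assume v: "X *v v = \<mu> *s v" "v \<noteq> 0" "\<mu> \<noteq> 0"
  have "\<mu> *s (M *v v) = (M ** X) *v v"
    by (simp add: matrix_vector_mul_assoc[symmetric] v(1) vector_scalar_commute)
  also have "\<dots> = v"
    using eigenvector_avg_eq_0[OF assms(4) v(1,3)] by (simp add: MX matrix_vector_mult_diff_rdistrib)
  finally have "M *v v = inverse \<mu> *s v"
    using v(3) by (metis vec.scale_left_imp_eq vector_smult_assoc right_inverse vector_smult_lid)
  then have "Re (inverse \<mu>) > 0"
    using eigenvalue_of_achieves_consensus assms v by (metis inverse_nonzero_iff_nonzero)
  then show "Re \<mu> > 0"
    using v(3) by (simp add: zero_less_divide_iff complex_neq_0)
qed (use assms in auto)

section \<open>The pseudoinverse of the Laplacian\<close>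

lemma charpoly_nonzero: "charpoly M \<noteq> 0"
proof
  assume "charpoly M = 0"
  \<comment> \<open>\<open>B\<close> bounds the operator norm, so \<open>B + 1\<close> exceeds the
    modulus of every eigenvalue.\<close>
  obtain B where B: "B > 0" "\<And>v. norm (M *v v) \<le> norm v * B"
    using bounded_linear.pos_bounded[OF matrix_vector_mul_bounded_linear[of M]] by blast
  obtain v where v: "v \<noteq> 0" "M *v v = of_real (B + 1) *s v"
    using \<open>charpoly M = 0\<close> poly_charpoly_eq_0_iff[of M "of_real (B + 1)"] by auto
  have "of_real (B + 1) *s v = (B + 1) *\<^sub>R v"
    by (simp add: vec_eq_iff scaleR_conv_of_real[where 'a = complex] distrib_right)
  then have "norm v * (B + 1) \<le> norm v * B"
    using B(2)[of v] v(2) B(1) by (simp add: mult.commute)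
  then show False using v(1) by simp
qed

text \<open>Replacing two columns of the identity by the kernel vectors \<open>ones\<close> and \<open>v\<close> gives an
  invertible matrix \<open>B\<close>, and two columns of \<open>(z - L) B\<close> are divisible by \<open>z\<close>.\<close>

lemma kernel_of_simple_eigenvalue_0:
  fixes L :: "complex^'n^'n"
  assumes simple: "simple_eigenvalue L 0" and "L *v ones = 0" and "L *v v = 0"
  shows "v $ i = v $ j"
proof (rule ccontr)
  assume ne: "v $ i \<noteq> v $ j"
  then have "i \<noteq> j" by auto
  \<comment> \<open>\<open>R\<close> is the transpose of the matrix \<open>B\<close> described
    above: its determinant is manipulated by rows.\<close>
  define R :: "complex^'n^'n" where
    "R = (\<chi> k. if k = i then v else if k = j then ones else axis k 1)"
  have sum_R: "transpose R *v x
      = x $ i *s v + x $ j *s ones + (\<chi> l. if l = i \<or> l = j then 0 else x $ l)" for x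
  proof -
    have "R $ k $ l * x $ k = (if k = i then x $ i * v $ l else 0) + (if k = j then x $ j else 0)
        + (if k = l then if l = i \<or> l = j then 0 else x $ l else 0)" for k l
      using \<open>i \<noteq> j\<close> by (auto simp: R_def ones_def axis_def)
    then show ?thesis
      by (simp add: vec_eq_iff matrix_vector_mult_def transpose_def sum.distrib ones_def)
  qed
  have "x = 0" if "transpose R *v x = 0" for x
  proof -
    have eq: "x $ i * v $ l + x $ j + (if l = i \<or> l = j then 0 else x $ l) = 0" for l
      using arg_cong[OF that[unfolded sum_R], of "\<lambda>y. y $ l"] by (simp add: ones_def)
    \<comment> \<open>Coordinates \<open>i\<close> and \<open>j\<close> form a 2 by 2 system with
      determinant \<open>v $ i - v $ j\<close>.\<close>
    have "x $ i * (v $ i - v $ j) = (x $ i * v $ i + x $ j) - (x $ i * v $ j + x $ j)"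
      by (simp add: algebra_simps)
    also have "\<dots> = 0" using eq[of i] eq[of j] by simp
    finally have "x $ i * (v $ i - v $ j) = 0" .
    then have "x $ i = 0" using ne by simp
    then have "x $ j = 0" using eq[of i] by simp
    have "x $ l = 0" for l
      using eq[of l] \<open>x $ i = 0\<close> \<open>x $ j = 0\<close> by (auto split: if_splits)
    then show "x = 0" by (simp add: vec_eq_iff)
  qed
  then have det_R: "det R \<noteq> 0"
    using matrix_left_invertible_ker[of "transpose R"] invertible_left_inverse invertible_det_nz
    by (metis det_transpose)
  \<comment> \<open>What remains after extracting a factor z from rows \<open>i\<close> and
    \<open>j\<close>. The \<open>1\<close> is the constant vector of polynomials matching
    \<open>ones\<close>; the indices of \<open>L\<close> are swapped by the transposition.\<close>
  define q where "q = det (\<chi> k. if k = i then (\<chi> l. [:v $ l:]) else if k = j then 1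
     else (\<chi> l. (if k = l then [:0, 1:] else 0) - [:L $ l $ k:]))"
  have "poly (charpoly L) z * det R = z\<^sup>2 * poly q z" for z
  proof -
    define N where "N = (\<chi> k l. (if k = l then z else 0) - L $ l $ k)"
    have mz: "mat z *v w = z *s w" for w :: "complex^'n"
      by (simp add: vec_eq_iff matrix_vector_mult_def mat_def if_distrib[of "\<lambda>c. c * _"]
          cong: if_cong)
    have row: "(R ** transpose (mat z - L)) $ k = (mat z - L) *v (R $ k)" for k
      by (simp add: vec_eq_iff matrix_matrix_mult_def matrix_vector_mult_def transpose_def
          mult.commute)
    have "R ** transpose (mat z - L)
        = (\<chi> k. if k = i then z *s v else if k = j then z *s ones else N $ k)"
      unfolding vec_eq_iff[of "R ** _"]
    proof
      fix k
      have "(mat z - L) *v axis k 1 = N $ k"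
        by (auto simp: vec_eq_iff matrix_vector_mult_def N_def mat_def axis_def
            if_distrib[of "\<lambda>c. _ * c"] cong: if_cong)
      then show "(R ** transpose (mat z - L)) $ k
          = (\<chi> k. if k = i then z *s v else if k = j then z *s ones else N $ k) $ k"
        unfolding row using assms(2,3)
        by (simp add: R_def matrix_vector_mult_diff_rdistrib mz)
    qed
    then have "poly (charpoly L) z * det R
        = det (\<chi> k. if k = i then z *s v else if k = j then z *s ones else N $ k)"
      by (metis poly_charpoly det_mul det_transpose mult.commute)
    also have "\<dots> = z * det (\<chi> k. if k = i then v else if k = j then z *s ones else N $ k)"
      by (rule det_row_mul)
    \<comment> \<open>Row \<open>j\<close> must be the outermost test before its factor can be
      extracted.\<close>
    also have "(\<chi> k. if k = i then v else if k = j then z *s ones else N $ k)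
        = (\<chi> k. if k = j then z *s ones else if k = i then v else N $ k)"
      using \<open>i \<noteq> j\<close> by (auto simp: vec_eq_iff)
    also have "det \<dots> = z * det (\<chi> k. if k = j then ones else if k = i then v else N $ k)"
      by (rule det_row_mul)
    also have "(\<chi> k. if k = j then ones else if k = i then v else N $ k)
        = (\<chi> k l. poly ((\<chi> k. if k = i then (\<chi> l. [:v $ l:]) else if k = j then 1
            else (\<chi> l. (if k = l then [:0, 1:] else 0) - [:L $ l $ k:])) $ k $ l) z)"
      using \<open>i \<noteq> j\<close> by (auto simp: vec_eq_iff ones_def N_def)
    also have "det \<dots> = poly q z"
      by (simp only: q_def poly_det)
    finally show ?thesis by (simp add: power2_eq_square mult.assoc)
  qed
  \<comment> \<open>Agreement at all points is a polynomial identity, so the square of X divides the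
    nonzero \<open>charpoly L\<close>, against order 1. Writing \<open>- 0\<close> matches the root
    factor in \<open>order_divides\<close>.\<close>
  then have "poly (smult (det R) (charpoly L)) = poly ([:- 0, 1:] ^ 2 * q)"
    by (auto simp: power2_eq_square mult.commute)
  then have "smult (det R) (charpoly L) = [:- 0, 1:] ^ 2 * q"
    by (simp only: poly_eq_poly_eq_iff)
  then have "[:- 0, 1:] ^ 2 dvd charpoly L"
    using det_R by (metis dvd_smult_cancel dvd_triv_left)
  then show False
    using simple charpoly_nonzero[of L]
    unfolding order_divides simple_eigenvalue_def alg_multiplicity_def by simp
qed

section \<open>The pseudoinverse when the kernel consists of constant vectors\<close>

lemma matrix_add_rdistrib: "(B + C) ** A = B ** A + C ** (A :: complex^'n^'n)"
  by (simp add: matrix_matrix_mult_def vec_eq_iff distrib_right sum.distrib)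

text \<open>\<open>mat 1 - pinv L ** L\<close> is Hermitian with range in the kernel of
  \<open>L\<close>, which forces it to be \<open>avg_mat\<close>.\<close>

lemma pinv_of_one_dim_kernel:
  fixes L :: "complex^'n^'n"
  assumes LJ: "L ** avg_mat = 0" and JL: "avg_mat ** L = 0"
    and ker: "\<And>v i j. L *v v = 0 \<Longrightarrow> v $ i = v $ j"
  shows "pinv L ** avg_mat = 0" "avg_mat ** pinv L = 0"
    "L ** pinv L = mat 1 - avg_mat" "pinv L ** L = mat 1 - avg_mat"
proof -
  let ?X = "pinv L" and ?J = "avg_mat :: complex^'n^'n"
  have X: "L ** ?X ** L = L" "?X ** L ** ?X = ?X" "conj_transpose (L ** ?X) = L ** ?X"
    "conj_transpose (?X ** L) = ?X ** L"
    using is_pinv_pinv[of L] by (auto simp: is_pinv_def)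
  define P where "P = mat 1 - ?X ** L"
  have "conj_transpose (mat 1 :: complex^'n^'n) = mat 1"
    by (simp add: conj_transpose_def vec_eq_iff mat_def)
  then have herm: "conj_transpose P = P"
    by (simp add: P_def conj_transpose_diff X)
  have "?J *v (P *v v) = P *v v" for v
  proof -
    have "L ** P = 0" by (simp add: P_def matrix_mult_diff_right matrix_mul_assoc X)
    then have "L *v (P *v v) = 0" by (simp add: matrix_vector_mul_assoc)
    from ker[OF this] have "P *v v = ((P *v v) $ undefined) *s ones"
      by (simp add: vec_eq_iff ones_def)
    then show ?thesis by (metis avg_mat_ones vector_scalar_commute)
  qed
  then have "?J ** P = P" unfolding matrix_eq matrix_vector_mul_assoc by blast
  then have "P ** ?J = P"
    by (metis herm conj_transpose_mult conj_transpose_avg_mat)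
  moreover have "P ** ?J = ?J"
    by (simp add: P_def matrix_mult_diff_left matrix_mul_assoc[symmetric] LJ)
  ultimately have "P = ?J" by simp
  then show XL: "?X ** L = mat 1 - ?J" by (simp add: P_def algebra_simps)
  have "?J ** ?X = ?J ** (?X ** L ** ?X)" by (simp add: X)
  also have "\<dots> = 0"
    by (simp add: XL matrix_mul_assoc matrix_mult_diff_right)
  finally show JX: "?J ** ?X = 0" .
  \<comment> \<open>\<open>L ** ?X\<close> is Hermitian, so the vanishing of \<open>?J ** L\<close>
    carries over to the other side.\<close>
  have "L ** ?X ** ?J = conj_transpose (?J ** (L ** ?X))"
    by (simp only: conj_transpose_mult[of ?J] conj_transpose_avg_mat X(3))
  also have "\<dots> = 0" by (simp add: matrix_mul_assoc JL conj_transpose_def vec_eq_iff)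
  finally have "?X ** (L ** ?X ** ?J) = 0" by simp
  then show XJ: "?X ** ?J = 0"
    by (simp only: matrix_mul_assoc X(2))
  \<comment> \<open>A one-sided inverse of a square matrix is two-sided; expanding the reversed
    product gives the remaining identity.\<close>
  have "(?X + ?J) ** (L + ?J) = mat 1"
    by (simp add: matrix_add_ldistrib matrix_add_rdistrib XL XJ JL)
  then have "(L + ?J) ** (?X + ?J) = mat 1"
    by (simp add: matrix_left_right_inverse)
  then show "L ** ?X = mat 1 - ?J"
    by (simp add: matrix_add_ldistrib matrix_add_rdistrib LJ JX algebra_simps)
qed

section \<open>Graph Laplacians and the equivalence\<close>

lemma laplacian_ones: "laplacian A *v ones = 0"
proof -
  have "(if i = j then c else 0) * (1::complex) = (if i = j then c else 0)" for i j c by simp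
  then show ?thesis
    by (simp add: laplacian_def diag_mat_def ones_def vec_eq_iff matrix_vector_mult_def
        sum_subtractf)
qed

text \<open>In both cases row and column sums of \<open>A\<close> agree, so transposing the
  Laplacian gives the Laplacian of the transposed graph.\<close>

lemma transpose_laplacian_ones:
  assumes "undirected A \<or> weight_balanced A"
  shows "transpose (laplacian A) *v ones = 0"
proof -
  have "A *v ones = transpose A *v ones"
    using assms unfolding undirected_def weight_balanced_def by metis
  then have "transpose (laplacian A) = laplacian (transpose A)"
    by (auto simp: laplacian_def diag_mat_def transpose_def vec_eq_iff)
  then show ?thesis by (simp add: laplacian_ones)
qed

lemma mult_avg_mat_eq_0:
  fixes M :: "complex^'n^'n"
  assumes "M *v ones = 0" shows "M ** avg_mat = 0"
proof -
  have "M *v (avg_mat *v x) = 0" for x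
    by (simp add: avg_mat_mult_vec vector_scalar_commute assms)
  then show ?thesis by (simp add: matrix_eq matrix_vector_mul_assoc)
qed

theorem theorem2:
  fixes A L :: "complex^'n^'n"
  assumes "undirected A \<or> weight_balanced A"
    and "L = laplacian A"
    and "simple_eigenvalue L 0"
  shows "achieves_consensus L \<longleftrightarrow> achieves_consensus (pinv L)"
proof -
  have ones: "L *v ones = 0" "transpose L *v ones = 0"
    using assms laplacian_ones transpose_laplacian_ones by auto
  then have LJ: "L ** avg_mat = 0" by (simp add: mult_avg_mat_eq_0)
  have "transpose avg_mat = (avg_mat :: complex^'n^'n)"
    by (simp add: avg_mat_def transpose_def vec_eq_iff)
  then have "transpose (avg_mat ** L) = transpose 0"
    using mult_avg_mat_eq_0[OF ones(2)]
    by (simp add: matrix_transpose_mul) (simp add: transpose_def vec_eq_iff)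
  then have JL: "avg_mat ** L = 0"
    by (metis transpose_transpose)
  note X = pinv_of_one_dim_kernel[OF LJ JL kernel_of_simple_eigenvalue_0[OF assms(3) ones(1)]]
  show ?thesis
    \<comment> \<open>The converse exchanges the roles of \<open>L\<close> and
      \<open>pinv L\<close>, hence the swapped order of the two product identities.\<close>
    using achieves_consensus_transfer[OF LJ JL X]
      achieves_consensus_transfer[OF X(1,2) LJ JL X(4,3)] by blast
qed

end
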